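(* Let $G$ be a finite subgroup of the orthogonal group $O(n)$, acting effectively on $\mathbb{R}^n$ by its linear action. Let $\mathcal{A}(G)$ be the arrangement of all proper linear subspaces of $\mathbb{R}^n$ of the form $L(H)$, $H\le G$, and let $Y_{\mathcal{A}(G)}$ be its maximal De Concini–Procesi wonderful model with the induced $G$-action. Then $Y_{\mathcal{A}(G)}$ is a digitalization of the given action; that is, for every point $\omega\in Y_{\mathcal{A}(G)}$ the stabilizer $\{g\in G : g\omega=\omega\}$ is isomorphic to $(\mathbb{Z}/2)^k$ for some integer $k\ge 0$.
   Context: For a subgroup $H\le G$, $L(H)\subseteq\mathbb{R}^n$ denotes the linear span of all lines $\ell$ (one-dimensional linear subspaces) in $\mathbb{R}^n$ with $h\cdot\ell=\ell$ (as a set) for all $h\in H$. The arrangement $\mathcal{A}=\mathcal{A}(G)$ is $\{L(H) : H\le G,\ L(H)\subsetneq\mathbb{R}^n\}$; it is $G$-invariant. Maximal De Concini–Procesi model: for a finite family $\mathcal{A}$ of proper linear subspaces of a real vector space $V$, let $\mathcal{L}$ be the set of all intersections of subfamilies of $\mathcal{A}$, ordered by reverse inclusion, where the empty intersection $V$ is the minimal element $\hat 0$; let $\mathcal{L}_{>\hat 0}=\mathcal{L}\setminus\{\hat 0\}$ and $\mathcal{M}(\mathcal{A})=V\setminus\bigcup\mathcal{A}$. Define $$\Psi:\mathcal{M}(\mathcal{A})\to V\times\prod_{X\in\mathcal{L}_{>\hat 0}}\mathbb{P}(V/X),\qquad \Psi(x)=\big(x,(\langle x,X\rangle/X)_{X\in\mathcal{L}_{>\hat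 0}}\big),$$ where $\langle x,X\rangle$ is the linear span of $x$ and $X$, so that $\langle x,X\rangle/X$ is a point of the projective space $\mathbb{P}(V/X)$. The maximal model $Y_{\mathcal{A}}$ is the closure of the image of $\Psi$. If a finite group $G$ acts linearly on $V$ leaving $\mathcal{A}$ invariant, then $G$ acts on the product by $g(x,(x_X)_X)=(g(x),(g(x_{g^{-1}(X)}))_X)$, and this action preserves $Y_{\mathcal{A}}$. A digitalization of a group action is such a model on which all point stabilizers are elementary abelian $2$-groups, i.e. isomorphic to $(\mathbb{Z}/2)^k$ for some $k\ge 0$. *)

theory Defs
  imports
    "HOL-Analysis.Analysis"
    "HOL-Algebra.Group_Action"
    "HOL-Algebra.Elementary_Groups"
    "HOL-Algebra.Product_Groups"
begin

section \<open>Quotient topologies\<close>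

definition quotient_topology :: "'a topology \<Rightarrow> ('a \<Rightarrow> 'b) \<Rightarrow> 'b topology" where
  "quotient_topology T f =
     topology (\<lambda>U. U \<subseteq> f ` topspace T \<and> openin T {x \<in> topspace T. f x \<in> U})"

lemma openin_quotient_topology:
  "openin (quotient_topology T f) U \<longleftrightarrow>
     U \<subseteq> f ` topspace T \<and> openin T {x \<in> topspace T. f x \<in> U}"
proof -
  have "istopology (\<lambda>U. U \<subseteq> f ` topspace T \<and> openin T {x \<in> topspace T. f x \<in> U})"
    unfolding istopology_def
  proof (intro conjI allI impI)
    fix S U
    assume "S \<subseteq> f ` topspace T \<and> openin T {x \<in> topspace T. f x \<in> S}"
      and "U \<subseteq> f ` topspace T \<and> openin T {x \<in> topspace T. f x \<in> U}"
    moreover have "{x \<in> topspace T. f x \<in> S \<inter> U}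
        = {x \<in> topspace T. f x \<in> S} \<inter> {x \<in> topspace T. f x \<in> U}"
      by blast
    ultimately show "S \<inter> U \<subseteq> f ` topspace T"
        "openin T {x \<in> topspace T. f x \<in> S \<inter> U}"
      by auto
  next
    fix K
    assume K: "\<forall>U\<in>K. U \<subseteq> f ` topspace T \<and> openin T {x \<in> topspace T. f x \<in> U}"
    then show "\<Union>K \<subseteq> f ` topspace T" by blast
    have "{x \<in> topspace T. f x \<in> \<Union>K} = (\<Union>U\<in>K. {x \<in> topspace T. f x \<in> U})"
      by blast
    with K show "openin T {x \<in> topspace T. f x \<in> \<Union>K}"
      by (metis (no_types, lifting) openin_Union imageE)
  qed
  then show ?thesis
    by (simp add: quotient_topology_def)
qed

lemma topspace_quotient_topology [simp]:
  "topspace (quotient_topology T f) = f ` topspace T"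
proof (rule antisym)
  show "topspace (quotient_topology T f) \<subseteq> f ` topspace T"
    using openin_quotient_topology[of T f "topspace (quotient_topology T f)"] by simp
  have "{x \<in> topspace T. f x \<in> f ` topspace T} = topspace T" by blast
  then have "openin (quotient_topology T f) (f ` topspace T)"
    by (simp add: openin_quotient_topology)
  then show "f ` topspace T \<subseteq> topspace (quotient_topology T f)"
    by (rule openin_subset)
qed

lemma quotient_map_quotient_topology: "quotient_map T (quotient_topology T f) f"
  by (simp add: quotient_map_def openin_quotient_topology)

section \<open>Quotient spaces and their projectivizations\<close>

text \<open>For a linear subspace \<open>X\<close> of \<open>V\<close>, the elements of \<open>V / X\<close> are the cosets \<open>x + X\<close>;
  its zero vector is \<open>X\<close> itself.\<close>

definition vcoset :: "'v::euclidean_space set \<Rightarrow> 'v \<Rightarrow> 'v set" where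
  "vcoset X x = (+) x ` X"

definition quotient_space_top :: "'v::euclidean_space set \<Rightarrow> 'v set topology" where
  "quotient_space_top X = quotient_topology euclidean (vcoset X)"

definition quotient_scale :: "'v::euclidean_space set \<Rightarrow> real \<Rightarrow> 'v set \<Rightarrow> 'v set" where
  "quotient_scale X c v = (\<Union>y\<in>v. vcoset X (c *\<^sub>R y))"

text \<open>A point of \<open>\<P>(V / X)\<close> is a one-dimensional subspace of \<open>V / X\<close>, hence a set of cosets.
  The topology on \<open>\<P>(V / X)\<close> is the quotient topology from the nonzero vectors of \<open>V / X\<close>.\<close>

definition quotient_line :: "'v::euclidean_space set \<Rightarrow> 'v set \<Rightarrow> 'v set set" where
  "quotient_line X v = range (\<lambda>c. quotient_scale X c v)"

definition proj_quotient_top :: "'v::euclidean_space set \<Rightarrow> 'v set set topology" where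
  "proj_quotient_top X =
     quotient_topology (subtopology (quotient_space_top X) (- {X})) (quotient_line X)"

text \<open>\<open>\<langle>x, X\<rangle> / X\<close>\<close>

definition span_mod :: "'v::euclidean_space \<Rightarrow> 'v set \<Rightarrow> 'v set set" where
  "span_mod x X = vcoset X ` span (insert x X)"

lemma vcoset_eq_iff:
  assumes "subspace X"
  shows "vcoset X x = vcoset X y \<longleftrightarrow> x - y \<in> X"
proof
  assume "vcoset X x = vcoset X y"
  moreover have "x \<in> vcoset X x"
    using subspace_0[OF assms] by (force simp: vcoset_def)
  ultimately show "x - y \<in> X" by (auto simp: vcoset_def)
next
  assume xy: "x - y \<in> X"
  have *: "vcoset X a \<subseteq> vcoset X b" if "a - b \<in> X" for a b
  proof
    fix z assume "z \<in> vcoset X a"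
    then obtain u where "u \<in> X" "z = a + u" by (auto simp: vcoset_def)
    then have "z = b + ((a - b) + u)" "(a - b) + u \<in> X"
      using subspace_add[OF assms that] by auto
    then show "z \<in> vcoset X b" unfolding vcoset_def by blast
  qed
  have "y - x \<in> X" using subspace_neg[OF assms xy] by simp
  with xy * show "vcoset X x = vcoset X y" by blast
qed

lemma quotient_scale_vcoset:
  assumes "subspace X"
  shows "quotient_scale X c (vcoset X x) = vcoset X (c *\<^sub>R x)"
proof -
  have "vcoset X (c *\<^sub>R y) = vcoset X (c *\<^sub>R x)" if "y \<in> vcoset X x" for y
  proof -
    from that obtain u where "u \<in> X" "y = x + u" by (auto simp: vcoset_def)
    then have "c *\<^sub>R y - c *\<^sub>R x \<in> X"
      using subspace_scale[OF assms] by (simp add: scaleR_right_distrib)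
    then show ?thesis using vcoset_eq_iff[OF assms] by blast
  qed
  moreover have "x \<in> vcoset X x"
    using subspace_0[OF assms] by (force simp: vcoset_def)
  ultimately show ?thesis unfolding quotient_scale_def by blast
qed

lemma span_mod_eq_quotient_line:
  assumes "subspace X"
  shows "span_mod x X = quotient_line X (vcoset X x)"
proof -
  have "vcoset X ` span (insert x X) = range (\<lambda>c. vcoset X (c *\<^sub>R x))"
  proof (intro equalityI subsetI)
    fix v assume "v \<in> vcoset X ` span (insert x X)"
    then obtain y c where "v = vcoset X y" "y - c *\<^sub>R x \<in> X"
      using assms by (auto simp: span_insert span_eq_iff[THEN iffD2])
    then show "v \<in> range (\<lambda>c. vcoset X (c *\<^sub>R x))"
      using vcoset_eq_iff[OF assms] by blast
  next
    fix v assume "v \<in> range (\<lambda>c. vcoset X (c *\<^sub>R x))"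
    then show "v \<in> vcoset X ` span (insert x X)"
      using span_scale[OF span_base[of x "insert x X"]] by blast
  qed
  then show ?thesis
    by (simp add: span_mod_def quotient_line_def quotient_scale_vcoset[OF assms])
qed

lemma span_mod_in_proj_quotient:
  assumes "subspace X" "x \<notin> X"
  shows "span_mod x X \<in> topspace (proj_quotient_top X)"
proof -
  have "vcoset X x \<noteq> X"
    using assms subspace_0[OF assms(1)] by (force simp: vcoset_def)
  then show ?thesis
    by (auto simp: proj_quotient_top_def quotient_space_top_def
        span_mod_eq_quotient_line[OF assms(1)])
qed

section \<open>The maximal De Concini--Procesi model\<close>

text \<open>The empty intersection is \<open>\<Inter>{} = UNIV\<close>, the minimal element of the lattice.\<close>

definition intersections :: "'v set set \<Rightarrow> 'v set set" where
  "intersections \<A> = {\<Inter>\<B> |\<B>. \<B> \<subseteq> \<A>}"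

definition intersections_pos :: "'v set set \<Rightarrow> 'v set set" where
  "intersections_pos \<A> = intersections \<A> - {UNIV}"

definition arr_complement :: "'v set set \<Rightarrow> 'v set" where
  "arr_complement \<A> = UNIV - \<Union>\<A>"

text \<open>Families indexed by \<open>intersections_pos \<A>\<close> are extensional functions.\<close>

type_synonym 'v model_point = "'v \<times> ('v set \<Rightarrow> 'v set set)"

definition ambient_top :: "'v::euclidean_space set set \<Rightarrow> 'v model_point topology" where
  "ambient_top \<A> =
     prod_topology euclidean (product_topology proj_quotient_top (intersections_pos \<A>))"

definition model_map :: "'v::euclidean_space set set \<Rightarrow> 'v \<Rightarrow> 'v model_point" where
  "model_map \<A> x = (x, \<lambda>X\<in>intersections_pos \<A>. span_mod x X)"

definition maximal_model :: "'v::euclidean_space set set \<Rightarrow> 'v model_point set" where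
  "maximal_model \<A> = ambient_top \<A> closure_of (model_map \<A> ` arr_complement \<A>)"

lemma model_map_in_ambient:
  assumes "\<And>X. X \<in> \<A> \<Longrightarrow> subspace X" "x \<in> arr_complement \<A>"
  shows "model_map \<A> x \<in> topspace (ambient_top \<A>)"
proof -
  have "span_mod x X \<in> topspace (proj_quotient_top X)"
    if X: "X \<in> intersections_pos \<A>" for X
  proof -
    from X obtain \<B> where B: "\<B> \<subseteq> \<A>" "X = \<Inter>\<B>" "X \<noteq> UNIV"
      by (auto simp: intersections_pos_def intersections_def)
    then have "\<B> \<noteq> {}" by auto
    then have "x \<notin> X" using B assms(2) by (auto simp: arr_complement_def)
    moreover have "subspace X"
      unfolding B(2) using B(1) assms(1) by (auto intro: subspace_Inter)
    ultimately show ?thesis by (rule span_mod_in_proj_quotient[rotated])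
  qed
  then show ?thesis
    by (auto simp: ambient_top_def model_map_def)
qed

text \<open>\<open>g (x, (x\<^sub>X)\<^sub>X) = (g x, (g (x\<^bsub>g\<^sup>-\<^sup>1 X\<^esub>))\<^sub>X)\<close>. A component is a set of cosets,
  so \<open>g\<close> acts on it by the image of images.\<close>

definition model_action ::
    "'v::euclidean_space set set \<Rightarrow> ('v \<Rightarrow> 'v) \<Rightarrow> 'v model_point \<Rightarrow> 'v model_point" where
  "model_action \<A> g \<omega> =
     (g (fst \<omega>), \<lambda>X\<in>intersections_pos \<A>. image (image g) (snd \<omega> (g -` X)))"

section \<open>Finite subgroups of the orthogonal group and their arrangements\<close>

definition orthogonal_group :: "(real^'n^'n) monoid" where
  "orthogonal_group = \<lparr>carrier = {A. orthogonal_matrix A}, monoid.mult = (**), one = mat 1\<rparr>"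

lemma group_orthogonal_group: "group (orthogonal_group :: (real^'n^'n) monoid)"
proof (rule groupI)
  fix A :: "real^'n^'n"
  assume "A \<in> carrier orthogonal_group"
  then show "\<exists>B\<in>carrier orthogonal_group.
      B \<otimes>\<^bsub>orthogonal_group\<^esub> A = \<one>\<^bsub>orthogonal_group\<^esub>"
    by (intro bexI[of _ "transpose A"])
      (auto simp: orthogonal_group_def orthogonal_matrix_def)
qed (auto simp: orthogonal_group_def matrix_mul_assoc orthogonal_matrix_mul orthogonal_matrix_id)

text \<open>The linear action of a subgroup of \<open>O(n)\<close> is automatically effective.\<close>

lemma orthogonal_group_effective:
  fixes A :: "real^'n^'n"
  assumes "\<And>x. A *v x = x"
  shows "A = \<one>\<^bsub>orthogonal_group\<^esub>"
  using assms by (simp add: orthogonal_group_def matrix_eq)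

definition invariant_line_span :: "(real^'n^'n) set \<Rightarrow> (real^'n) set" where
  "invariant_line_span H =
     span (\<Union>{l. subspace l \<and> dim l = 1 \<and> (\<forall>h\<in>H. (*v) h ` l = l)})"

definition group_arrangement :: "(real^'n^'n) set \<Rightarrow> (real^'n) set set" where
  "group_arrangement G =
     {invariant_line_span H |H.
        subgroup H (orthogonal_group\<lparr>carrier := G\<rparr>) \<and> invariant_line_span H \<subset> UNIV}"

section \<open>Digitalizations\<close>

definition elementary_abelian_2_group :: "('a, 'b) monoid_scheme \<Rightarrow> bool" where
  "elementary_abelian_2_group S \<longleftrightarrow>
     (\<exists>k::nat. S \<cong> product_group {..<k} (\<lambda>_. integer_mod_group 2))"

definition digitalization ::
    "('g, 'b) monoid_scheme \<Rightarrow> ('g \<Rightarrow> 'y \<Rightarrow> 'y) \<Rightarrow> 'y set \<Rightarrow> bool" where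
  "digitalization G act Y \<longleftrightarrow>
     (\<forall>\<omega>\<in>Y. elementary_abelian_2_group (G\<lparr>carrier := stabilizer G act \<omega>\<rparr>))"

end

(*
  Let S be the stabilizer of a point \<omega> of the model and suppose that L = L(S) is a proper subspace.
  Then L belongs to the arrangement, and the component of \<omega> at L is an S-invariant line in V / L.
  Since S acts orthogonally, that line lifts to an S-invariant line perpendicular to L, which by
  definition of L(S) lies in L: a contradiction.  Hence the S-invariant lines span V, every element of
  S acts on each of them by 1 or -1, and S has exponent 2.  The argument uses only that \<omega> lies in the
  ambient product, not that it is in the closure of the image of the model map.
*)
theory Submission
  imports Defs
begin

section \<open>Finite groups of exponent two\<close>

text \<open>Every element is its own inverse, so inverting a product, which reverses its factors,
  also leaves it unchanged.\<close>

lemma (in group) exponent_2_imp_comm: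
  assumes sq: "\<And>x. x \<in> carrier G \<Longrightarrow> x \<otimes> x = \<one>"
    and "x \<in> carrier G" "y \<in> carrier G"
  shows "x \<otimes> y = y \<otimes> x"
proof -
  have i: "inv a = a" if "a \<in> carrier G" for a
    using sq that by (simp add: inv_equality)
  show ?thesis
    using assms i[of x] i[of y] i[of "x \<otimes> y"] inv_mult_group[of x y] by simp
qed

text \<open>Growth step for embeddings of powers of Z/2: the additional coordinate is sent to a
  missed element \<open>g\<close>. Commutativity makes the enlarged map a homomorphism, and
  \<open>g\<close> lying outside the old image keeps it injective.\<close>

lemma (in group) exponent_2_extend_mon:
  fixes k :: nat
  defines "P \<equiv> \<lambda>k::nat. product_group {..<k} (\<lambda>_. integer_mod_group 2)"
  assumes sq: "\<And>x. x \<in> carrier G \<Longrightarrow> x \<otimes> x = \<one>"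
    and \<phi>: "\<phi> \<in> mon (P k) G"
    and g: "g \<in> carrier G" "g \<notin> \<phi> ` carrier (P k)"
  shows "\<exists>\<psi> \<in> mon (P (Suc k)) G. \<phi> ` carrier (P k) \<subset> \<psi> ` carrier (P (Suc k))"
proof -
  have grp: "group (P m)" for m
    by (simp add: P_def)
  have bit: "f i = 0 \<or> f i = 1" if "f \<in> carrier (P m)" "i < m" for f :: "nat \<Rightarrow> int" and i m
  proof -
    have "f i \<in> {0..<2}"
      using that by (auto simp: P_def carrier_integer_mod_group PiE_iff)
    then show ?thesis by auto
  qed
  have res: "restrict f {..<k} \<in> carrier (P k)" if "f \<in> carrier (P (Suc k))" for f
    using that by (auto simp: P_def carrier_integer_mod_group PiE_iff)
  have hom\<phi>: "\<phi> \<in> hom (P k) G" and inj: "inj_on \<phi> (carrier (P k))"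
    using \<phi> by (auto simp: mon_def)
  then have cl: "\<phi> f \<in> carrier G" if "f \<in> carrier (P k)" for f
    using that by (auto simp: hom_def)
  have mul: "\<phi> (f \<otimes>\<^bsub>P k\<^esub> f') = \<phi> f \<otimes> \<phi> f'" if "f \<in> carrier (P k)" "f' \<in> carrier (P k)" for f f'
    using that hom\<phi> by (auto simp: hom_def)
  \<comment> \<open>\<open>e\<close> is the homomorphism from Z/2 that takes 1 to \<open>g\<close>;
    it respects addition modulo 2 because \<open>g\<close> squares to the identity.\<close>
  define e where "e c = (if c = (1::int) then g else \<one>)" for c
  have e_cl: "e c \<in> carrier G" for c
    using g by (simp add: e_def)
  have e_add: "e ((c + d) mod 2) = e c \<otimes> e d" if "c = 0 \<or> c = 1" "d = 0 \<or> d = 1" for c d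
    using that g sq[OF g(1)] by (auto simp: e_def)
  define \<psi> where "\<psi> f = \<phi> (restrict f {..<k}) \<otimes> e (f k)" for f
  have hom\<psi>: "\<psi> \<in> hom (P (Suc k)) G"
  proof (rule homI)
    fix f assume "f \<in> carrier (P (Suc k))"
    then show "\<psi> f \<in> carrier G"
      by (simp add: \<psi>_def cl res e_cl)
  next
    fix f f' assume f: "f \<in> carrier (P (Suc k))" "f' \<in> carrier (P (Suc k))"
    have r: "restrict (f \<otimes>\<^bsub>P (Suc k)\<^esub> f') {..<k} = restrict f {..<k} \<otimes>\<^bsub>P k\<^esub> restrict f' {..<k}"
      by (auto simp: P_def)
    have k: "(f \<otimes>\<^bsub>P (Suc k)\<^esub> f') k = (f k + f' k) mod 2"
      by (simp add: P_def)
    have "\<psi> (f \<otimes>\<^bsub>P (Suc k)\<^esub> f')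
        = (\<phi> (restrict f {..<k}) \<otimes> \<phi> (restrict f' {..<k})) \<otimes> (e (f k) \<otimes> e (f' k))"
      unfolding \<psi>_def r k using f res mul e_add bit by (metis lessI)
    also have "\<dots> = \<psi> f \<otimes> \<psi> f'"
      unfolding \<psi>_def using res[OF f(1)] res[OF f(2)]
        exponent_2_imp_comm[OF sq, of "\<phi> (restrict f' {..<k})" "e (f k)"]
      by (metis m_assoc cl e_cl m_closed)
    finally show "\<psi> (f \<otimes>\<^bsub>P (Suc k)\<^esub> f') = \<psi> f \<otimes> \<psi> f'" .
  qed
  have "inj_on \<psi> (carrier (P (Suc k)))"
  proof (subst inj_on_one_iff'[OF hom\<psi> grp is_group], intro allI impI)
    fix f assume f: "f \<in> carrier (P (Suc k))" and eq: "\<psi> f = \<one>"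
    let ?r = "restrict f {..<k}"
    \<comment> \<open>If the new coordinate of a kernel element were 1, then \<open>g\<close>, being
      its own inverse, would equal \<open>\<phi> ?r\<close> and lie in the old image.\<close>
    have "f k = 0"
    proof (rule ccontr)
      assume "f k \<noteq> 0"
      then have "f k = 1" using bit[OF f, of k] by simp
      then have "\<phi> ?r \<otimes> g = \<one>" using eq by (simp add: \<psi>_def e_def)
      then have "g = \<phi> ?r"
        using sq[OF g(1)] cl[OF res[OF f]] g(1) by (metis inv_equality)
      then show False using g(2) res[OF f] by blast
    qed
    then have "\<phi> ?r = \<one>" using eq cl[OF res[OF f]] by (simp add: \<psi>_def e_def)
    then have r1: "?r = \<one>\<^bsub>P k\<^esub>"
      using inj_on_one_iff'[OF hom\<phi> grp is_group] inj res[OF f] by blast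
    show "f = \<one>\<^bsub>P (Suc k)\<^esub>"
    proof (rule ext)
      fix i
      show "f i = \<one>\<^bsub>P (Suc k)\<^esub> i"
        using fun_cong[OF r1, of i] \<open>f k = 0\<close> f
        by (cases "i < k"; cases "i = k") (auto simp: P_def PiE_iff extensional_def)
    qed
  qed
  with hom\<psi> have mon: "\<psi> \<in> mon (P (Suc k)) G" by (simp add: mon_def)
  \<comment> \<open>Elements of \<open>P k\<close> are undefined at \<open>k\<close>, so setting a
    bit there loses nothing. Bit 0 recovers the old image; bit 1 on the identity yields
    \<open>g\<close>.\<close>
  have ext: "f(k := c) \<in> carrier (P (Suc k)) \<and> \<psi> (f(k := c)) = \<phi> f \<otimes> e c"
    if "f \<in> carrier (P k)" "c = 0 \<or> c = 1" for f c
  proof -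
    have "restrict (f(k := c)) {..<k} = f"
      using that by (auto simp: P_def PiE_iff extensional_def)
    moreover have "f(k := c) \<in> carrier (P (Suc k))"
      using that by (auto simp: P_def PiE_iff extensional_def carrier_integer_mod_group)
    ultimately show ?thesis by (simp add: \<psi>_def)
  qed
  have "\<phi> ` carrier (P k) \<subseteq> \<psi> ` carrier (P (Suc k))"
  proof (rule image_subsetI)
    fix f assume f: "f \<in> carrier (P k)"
    with ext[of f 0] cl show "\<phi> f \<in> \<psi> ` carrier (P (Suc k))"
      by (auto simp: e_def intro!: image_eqI[where x = "f(k := 0)"])
  qed
  moreover have "g \<in> \<psi> ` carrier (P (Suc k))"
  proof -
    have "\<one>\<^bsub>P k\<^esub> \<in> carrier (P k)" "\<phi> \<one>\<^bsub>P k\<^esub> = \<one>"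
      using hom_one[OF hom\<phi> grp is_group] group.is_monoid[OF grp] by (auto intro: monoid.one_closed)
    with ext[of "\<one>\<^bsub>P k\<^esub>" 1] g show ?thesis
      by (metis e_def imageI l_one)
  qed
  ultimately show ?thesis using mon g(2) by blast
qed

text \<open>An embedding of a power of Z/2 whose image has the largest possible cardinality must be
  onto: a missed element would allow a strictly larger image.\<close>

lemma (in group) elementary_abelian_2_groupI:
  assumes "finite (carrier G)"
    and sq: "\<And>x. x \<in> carrier G \<Longrightarrow> x \<otimes> x = \<one>"
  shows "elementary_abelian_2_group G"
proof -
  define P where "P k = product_group {..<k} (\<lambda>_. integer_mod_group 2)" for k :: nat
  define C where "C c \<longleftrightarrow> (\<exists>k. \<exists>\<phi> \<in> mon (P k) G. card (\<phi> ` carrier (P k)) = c)" for c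
  have sub: "\<phi> ` carrier (P k) \<subseteq> carrier G" if "\<phi> \<in> mon (P k) G" for \<phi> k
    using that by (auto simp: mon_def hom_def)
  \<comment> \<open>The empty product is the trivial group, so at least one embedding exists;
    finiteness of the group bounds all the cardinalities.\<close>
  have "(\<lambda>_. \<one>) \<in> mon (P 0) G"
    by (auto simp: mon_def hom_def P_def)
  then have ex: "\<exists>c. C c" unfolding C_def by blast
  have bound: "c \<le> card (carrier G)" if "C c" for c
    using that sub assms(1) unfolding C_def by (metis card_mono)
  have max: "d \<le> Greatest C" if "C d" for d
    using that bound by (rule Greatest_le_nat)
  have "C (Greatest C)"
    using ex bound by (rule GreatestI_ex_nat)
  then obtain k \<phi> where \<phi>: "\<phi> \<in> mon (P k) G" "card (\<phi> ` carrier (P k)) = Greatest C"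
    unfolding C_def by blast
  have "\<phi> ` carrier (P k) = carrier G"
  proof (rule ccontr)
    assume "\<phi> ` carrier (P k) \<noteq> carrier G"
    with sub[OF \<phi>(1)] obtain g where "g \<in> carrier G" "g \<notin> \<phi> ` carrier (P k)" by blast
    then obtain \<psi> where \<psi>: "\<psi> \<in> mon (P (Suc k)) G"
        "\<phi> ` carrier (P k) \<subset> \<psi> ` carrier (P (Suc k))"
      using exponent_2_extend_mon[OF sq, of \<phi> k g] \<phi>(1) unfolding P_def by blast
    then have "Greatest C < card (\<psi> ` carrier (P (Suc k)))"
      using \<phi>(2) sub[OF \<psi>(1)] assms(1) by (metis finite_subset psubset_card_mono)
    moreover have "C (card (\<psi> ` carrier (P (Suc k))))"
      using \<psi>(1) unfolding C_def by blast
    ultimately show False using max by (simp add: leD)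
  qed
  with \<phi>(1) have "\<phi> \<in> iso (P k) G"
    by (auto simp: iso_def mon_def bij_betw_def)
  then have "P k \<cong> G" by (rule is_isoI)
  moreover have "group (P k)" by (simp add: P_def)
  ultimately have "G \<cong> P k" by (simp add: group.iso_sym)
  then show ?thesis unfolding elementary_abelian_2_group_def P_def by blast
qed

section \<open>Cosets and orthogonal maps\<close>

lemma vcoset_image_linear:
  assumes "linear f"
  shows "f ` vcoset X x = vcoset (f ` X) (f x)"
  using assms by (auto simp: vcoset_def linear_add image_image)

lemma orthogonal_transformation_matrix_vector_mult:
  assumes "orthogonal_matrix (A :: real^'n^'n)"
  shows "orthogonal_transformation ((*v) A)"
  using assms by (simp add: orthogonal_transformation_matrix matrix_vector_mul_linear)

lemma matrix_vector_mul_transpose_cancel: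
  assumes "orthogonal_matrix (A :: real^'n^'n)"
  shows "transpose A *v (A *v x) = x" "A *v (transpose A *v x) = x"
  using assms
  by (simp_all only: orthogonal_matrix_def matrix_vector_mul_assoc matrix_vector_mul_lid)

text \<open>The model action indexes components by preimages, while spans of lines are transported
  by images; the transpose, being the inverse, links the two.\<close>

lemma vimage_orthogonal_matrix:
  assumes "orthogonal_matrix (A :: real^'n^'n)"
  shows "(*v) A -` X = (*v) (transpose A) ` X"
proof (intro equalityI subsetI)
  fix x assume "x \<in> (*v) A -` X"
  then show "x \<in> (*v) (transpose A) ` X"
    using matrix_vector_mul_transpose_cancel(1)[OF assms, of x] by (metis image_eqI vimageD)
next
  fix x assume "x \<in> (*v) (transpose A) ` X"
  then show "x \<in> (*v) A -` X"
    using matrix_vector_mul_transpose_cancel(2)[OF assms] by (auto simp del: transpose_matrix_vector)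
qed

text \<open>On an invariant line the map is multiplication by a scalar, and preservation of the norm
  forces that scalar to be 1 or -1.\<close>

lemma orthogonal_transformation_involutive_on_line:
  fixes f :: "'a::euclidean_space \<Rightarrow> 'a"
  assumes f: "orthogonal_transformation f"
    and l: "subspace l" "dim l = 1" "f ` l \<subseteq> l" and x: "x \<in> l"
  shows "f (f x) = x"
proof (cases "x = 0")
  case True
  with f show ?thesis by (simp add: orthogonal_transformation_def linear_0)
next
  case False
  have "span {x} = l"
    by (rule subspace_dim_equal) (use False l x in \<open>auto simp: span_minimal\<close>)
  then obtain c where c: "f x = c *\<^sub>R x"
    using l(3) x by (auto simp: span_singleton)
  have lin: "linear f" using f by (simp add: orthogonal_transformation_def)
  have "norm (f x) = norm x" using f by (simp add: orthogonal_transformation)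
  with c False have "\<bar>c\<bar> = 1" by simp
  then have "c * c = 1" by (metis abs_mult_self_eq mult_1)
  then show ?thesis by (simp add: c linear_scale[OF lin])
qed

section \<open>Spans of invariant lines\<close>

text \<open>A common eigenvector gives only that the line is mapped into itself, whereas the
  definition of \<open>invariant_line_span\<close> asks for equality. Orthogonality makes the
  eigenvalue nonzero, which supplies the other inclusion.\<close>

lemma invariant_line_spanI:
  assumes "p \<noteq> 0" "\<And>h. h \<in> H \<Longrightarrow> orthogonal_matrix h"
    and ev: "\<And>h. h \<in> H \<Longrightarrow> h *v p \<in> span {p}"
  shows "p \<in> invariant_line_span H"
proof -
  have "(*v) h ` span {p} = span {p}" if h: "h \<in> H" for h
  proof -
    have ot: "orthogonal_transformation ((*v) h)"
      using assms(2)[OF h] by (rule orthogonal_transformation_matrix_vector_mult)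
    obtain c where c: "h *v p = c *\<^sub>R p"
      using ev[OF h] by (auto simp: span_singleton)
    have "h *v p \<noteq> 0"
      using ot assms(1) by (metis norm_eq_zero orthogonal_transformation_norm)
    then have "c \<noteq> 0" using c by auto
    have "(*v) h ` span {p} = span ((*v) h ` {p})"
      by (rule linear_span_image[OF matrix_vector_mul_linear, symmetric])
    also have "\<dots> = span {p}"
    proof -
      have "p = inverse c *\<^sub>R (h *v p)" using c \<open>c \<noteq> 0\<close> by simp
      then have "p \<in> span {h *v p}" by (metis insertI1 span_base span_scale)
      with ev[OF h] show ?thesis by (simp add: span_eq)
    qed
    finally show ?thesis .
  qed
  moreover have "dim (span {p}) = 1" using assms(1) by simp
  ultimately have "p \<in> \<Union>{l. subspace l \<and> dim l = 1 \<and> (\<forall>h\<in>H. (*v) h ` l = l)}"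
    using span_base[of p "{p}"] subspace_span by blast
  then show ?thesis unfolding invariant_line_span_def by (rule span_base)
qed

lemma image_invariant_line_span:
  assumes "h \<in> H"
  shows "(*v) h ` invariant_line_span H = invariant_line_span H"
proof -
  let ?U = "\<Union>{l. subspace l \<and> dim l = 1 \<and> (\<forall>h\<in>H. (*v) h ` l = l)}"
  have "(*v) h ` ?U = ?U"
    using assms by (subst image_Union) (intro arg_cong[where f = Union], force)
  then show ?thesis
    unfolding invariant_line_span_def by (simp add: linear_span_image[symmetric])
qed

text \<open>The square of \<open>h\<close> is linear and fixes every invariant line pointwise, hence
  it is the identity on their span.\<close>

lemma square_eq_1_if_invariant_line_span_UNIV:
  assumes "invariant_line_span H = UNIV" "h \<in> H" "orthogonal_matrix h"
  shows "h ** h = mat 1"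
proof -
  let ?U = "\<Union>{l. subspace l \<and> dim l = 1 \<and> (\<forall>h\<in>H. (*v) h ` l = l)}"
  have ot: "orthogonal_transformation ((*v) h)"
    using assms(3) by (rule orthogonal_transformation_matrix_vector_mult)
  have "h *v (h *v x) = x" for x
  proof -
    have "x \<in> span ?U" using assms(1) by (auto simp: invariant_line_span_def)
    moreover have "linear (\<lambda>x. h *v (h *v x))"
      by (simp add: matrix_vector_mul_assoc)
    moreover have "h *v (h *v x) = x" if "x \<in> ?U" for x
      using that orthogonal_transformation_involutive_on_line[OF ot] assms(2) by blast
    ultimately show ?thesis
      using linear_eq_on_span[of "\<lambda>x. h *v (h *v x)" "\<lambda>x. x" ?U x] by (simp add: linear_ident)
  qed
  then show ?thesis by (simp add: matrix_eq matrix_vector_mul_assoc)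
qed

text \<open>The orthogonal component \<open>p\<close> of a representative of the line in \<open>V / L\<close> spans an
  invariant line perpendicular to \<open>L\<close>.\<close>

lemma no_invariant_point_in_quotient:
  fixes H :: "(real^'n^'n) set"
  defines "L \<equiv> invariant_line_span H"
  assumes H: "\<And>h. h \<in> H \<Longrightarrow> orthogonal_matrix h"
    and P: "P \<in> topspace (proj_quotient_top L)"
  shows "\<exists>h\<in>H. image (image ((*v) h)) P \<noteq> P"
proof (rule ccontr)
  assume "\<not> (\<exists>h\<in>H. image (image ((*v) h)) P \<noteq> P)"
  then have fixP: "image (image ((*v) h)) P = P" if "h \<in> H" for h
    using that by blast
  have subL: "subspace L" by (simp add: L_def invariant_line_span_def)
  obtain x where x: "vcoset L x \<noteq> L" "P = span_mod x L"
    using P by (auto simp: proj_quotient_top_def quotient_space_top_def span_mod_eq_quotient_line[OF subL])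
  have "x \<notin> L"
    using x(1) vcoset_eq_iff[OF subL, of x 0] by (auto simp: vcoset_def)
  \<comment> \<open>Split the representative \<open>x\<close> into \<open>q\<close> in
    \<open>L\<close> and \<open>p\<close> perpendicular to \<open>L\<close>. Both represent the same
    line of the quotient, but \<open>p\<close> is a candidate for a genuine eigenvector.\<close>
  obtain q p where q: "q \<in> span L" and p: "\<And>w. w \<in> span L \<Longrightarrow> orthogonal p w" and xqp: "x = q + p"
    using orthogonal_subspace_decomp_exists by blast
  have qL: "q \<in> L" and pL: "\<And>w. w \<in> L \<Longrightarrow> p \<bullet> w = 0"
    using q p subL by (auto simp: span_eq_iff[THEN iffD2] orthogonal_def)
  have p0: "p \<noteq> 0" using \<open>x \<notin> L\<close> xqp qL by auto
  have "h *v p \<in> span {p}" if h: "h \<in> H" for h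
  proof -
    have hL: "(*v) h ` L = L"
      unfolding L_def using h by (rule image_invariant_line_span)
    have ot: "orthogonal_transformation ((*v) h)"
      using H[OF h] by (rule orthogonal_transformation_matrix_vector_mult)
    \<comment> \<open>Since \<open>P\<close> is fixed as a set of cosets, \<open>h\<close> sends the
      coset of \<open>x\<close> to another member of \<open>P\<close>, so \<open>h *v x\<close> is a
      multiple of \<open>x\<close> modulo \<open>L\<close>.\<close>
    have "vcoset L x \<in> P" unfolding x(2) span_mod_def
      by (intro imageI span_base insertI1)
    then have "(*v) h ` vcoset L x \<in> P"
      using fixP[OF h] by (metis imageI)
    then have "vcoset L (h *v x) \<in> P"
      by (simp add: vcoset_image_linear hL)
    then obtain y where y: "y \<in> span (insert x L)" "vcoset L (h *v x) = vcoset L y"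
      unfolding x(2) span_mod_def by blast
    then obtain c where c: "y - c *\<^sub>R x \<in> L"
      using subL by (auto simp: span_insert span_eq_iff[THEN iffD2])
    have "h *v x - y \<in> L" using y(2) vcoset_eq_iff[OF subL] by blast
    moreover have "h *v q \<in> L" using hL qL by blast
    \<comment> \<open>Subtracting the contributions of \<open>q\<close>, which stay in
      \<open>L\<close>, turns the congruence for \<open>x\<close> into one for
      \<open>p\<close>.\<close>
    ultimately have "(h *v x - y) + (y - c *\<^sub>R x) - h *v q + c *\<^sub>R q \<in> L"
      using c subspace_scale[OF subL qL, of c]
      by (meson subL subspace_add subspace_diff)
    also have "(h *v x - y) + (y - c *\<^sub>R x) - h *v q + c *\<^sub>R q = h *v p - c *\<^sub>R p"
      by (simp add: xqp matrix_vector_right_distrib scaleR_right_distrib)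
    finally have d: "h *v p - c *\<^sub>R p \<in> L" .
    \<comment> \<open>As \<open>h\<close> is orthogonal and maps \<open>L\<close> onto itself, it
      preserves perpendicularity to \<open>L\<close>. The difference is thus both in
      \<open>L\<close> and perpendicular to \<open>L\<close>, hence zero.\<close>
    have "(h *v p - c *\<^sub>R p) \<bullet> w = 0" if "w \<in> L" for w
    proof -
      have "w \<in> (*v) h ` L" using that by (simp only: hL)
      then obtain z where "z \<in> L" "w = h *v z" by blast
      then show ?thesis
        using ot pL that by (simp add: inner_diff_left orthogonal_transformation_def)
    qed
    from this[OF d] have "h *v p = c *\<^sub>R p"
      by (simp only: inner_eq_zero_iff right_minus_eq)
    then show ?thesis
      by (simp add: span_base span_scale)
  qed
  then have "p \<in> L"
    unfolding L_def using p0 H by (intro invariant_line_spanI)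
  with pL p0 show False by fastforce
qed

section \<open>Subgroups of the orthogonal group and invariance of the arrangement\<close>

lemma subgroup_orthogonal_groupD:
  assumes "subgroup G (orthogonal_group :: (real^'n^'n) monoid)"
  shows "g \<in> G \<Longrightarrow> orthogonal_matrix g"
    and "mat 1 \<in> G"
    and "g \<in> G \<Longrightarrow> h \<in> G \<Longrightarrow> g ** h \<in> G"
    and "g \<in> G \<Longrightarrow> transpose g \<in> G"
proof -
  interpret subgroup G "orthogonal_group :: (real^'n^'n) monoid" by fact
  show o: "orthogonal_matrix g" if "g \<in> G" for g
    using subset that by (auto simp: orthogonal_group_def)
  show "mat 1 \<in> G" "g \<in> G \<Longrightarrow> h \<in> G \<Longrightarrow> g ** h \<in> G"
    using one_closed m_closed by (auto simp: orthogonal_group_def)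
  show "transpose g \<in> G" if "g \<in> G"
  proof -
    have "inv\<^bsub>orthogonal_group\<^esub> g = transpose g"
      using o[OF that]
      by (intro group.inv_equality[OF group_orthogonal_group])
        (auto simp: orthogonal_group_def orthogonal_matrix_def)
    then show ?thesis using m_inv_closed[OF that] by simp
  qed
qed

lemma subgroup_orthogonal_groupI:
  fixes H :: "(real^'n^'n) set"
  assumes o: "\<And>h. h \<in> H \<Longrightarrow> orthogonal_matrix h"
    and "mat 1 \<in> H" "\<And>g h. g \<in> H \<Longrightarrow> h \<in> H \<Longrightarrow> g ** h \<in> H"
    and "\<And>g. g \<in> H \<Longrightarrow> transpose g \<in> H"
  shows "subgroup H orthogonal_group"
proof (rule group.subgroupI[OF group_orthogonal_group])
  fix g assume "g \<in> H"
  then have "inv\<^bsub>orthogonal_group\<^esub> g = transpose g"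
    using o by (intro group.inv_equality[OF group_orthogonal_group])
      (auto simp: orthogonal_group_def orthogonal_matrix_def)
  with \<open>g \<in> H\<close> assms show "inv\<^bsub>orthogonal_group\<^esub> g \<in> H" by simp
qed (use assms in \<open>auto simp: orthogonal_group_def\<close>)

lemma subgroup_orthogonal_subgroup_iff:
  assumes "subgroup G orthogonal_group"
  shows "subgroup H (orthogonal_group\<lparr>carrier := G\<rparr>) \<longleftrightarrow> subgroup H orthogonal_group \<and> H \<subseteq> G"
proof
  assume H: "subgroup H (orthogonal_group\<lparr>carrier := G\<rparr>)"
  show "subgroup H orthogonal_group \<and> H \<subseteq> G"
    using group.incl_subgroup[OF group_orthogonal_group assms H] subgroup.subset[OF H] by simp
next
  assume "subgroup H orthogonal_group \<and> H \<subseteq> G"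
  then show "subgroup H (orthogonal_group\<lparr>carrier := G\<rparr>)"
    using group.subgroup_incl[OF group_orthogonal_group _ assms] by blast
qed

lemma subgroup_conjugate_orthogonal:
  assumes "subgroup H orthogonal_group" "orthogonal_matrix (g :: real^'n^'n)"
  shows "subgroup ((\<lambda>h. g ** h ** transpose g) ` H) orthogonal_group"
proof -
  note H = subgroup_orthogonal_groupD[OF assms(1)]
  have g: "transpose g ** g = mat 1" "g ** transpose g = mat 1"
    using assms(2) by (auto simp: orthogonal_matrix_def)
  have mul: "(g ** h ** transpose g) ** (g ** k ** transpose g) = g ** (h ** k) ** transpose g" for h k
    by (metis g(1) matrix_mul_assoc matrix_mul_rid)
  show ?thesis
  proof (rule subgroup_orthogonal_groupI)
    fix k assume "k \<in> (\<lambda>h. g ** h ** transpose g) ` H"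
    then show "orthogonal_matrix k"
      using H(1) assms(2) by (auto intro!: orthogonal_matrix_mul simp: orthogonal_matrix_transpose)
  next
    show "mat 1 \<in> (\<lambda>h. g ** h ** transpose g) ` H"
      using H(2) g by (intro image_eqI[where x = "mat 1"]) auto
  next
    fix a b assume "a \<in> (\<lambda>h. g ** h ** transpose g) ` H" "b \<in> (\<lambda>h. g ** h ** transpose g) ` H"
    then show "a ** b \<in> (\<lambda>h. g ** h ** transpose g) ` H"
      using H(3) mul by auto
  next
    fix a assume "a \<in> (\<lambda>h. g ** h ** transpose g) ` H"
    then show "transpose a \<in> (\<lambda>h. g ** h ** transpose g) ` H"
      using H(4) by (auto simp: matrix_transpose_mul matrix_mul_assoc)
  qed
qed

text \<open>The conjugate of \<open>h\<close> acts on \<open>g *v x\<close> as \<open>g\<close>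
  applied to \<open>h *v x\<close>, so \<open>g\<close> carries lines invariant under
  \<open>H\<close> to lines invariant under the conjugate subgroup.\<close>

lemma image_invariant_line_span_conjugate_subset:
  assumes "orthogonal_matrix (g :: real^'n^'n)"
  shows "(*v) g ` invariant_line_span H \<subseteq> invariant_line_span ((\<lambda>h. g ** h ** transpose g) ` H)"
proof -
  have "(*v) g ` l \<in> {l. subspace l \<and> dim l = 1 \<and> (\<forall>h\<in>(\<lambda>h. g ** h ** transpose g) ` H. (*v) h ` l = l)}"
    if l: "subspace l" "dim l = 1" "\<forall>h\<in>H. (*v) h ` l = l" for l
  proof (intro CollectI conjI ballI)
    show "subspace ((*v) g ` l)" using l(1) by (simp add: linear_subspace_image)
    have "inj ((*v) g)"
      using orthogonal_transformation_matrix_vector_mult[OF assms] by (rule orthogonal_transformation_inj)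
    then show "dim ((*v) g ` l) = 1" using l(2) by (metis dim_image_eq inj_on_subset matrix_vector_mul_linear top_greatest)
    fix k assume "k \<in> (\<lambda>h. g ** h ** transpose g) ` H"
    then obtain h where h: "h \<in> H" "k = g ** h ** transpose g" by blast
    have "k *v (g *v x) = g *v (h *v x)" for x
      unfolding h(2)
      by (simp add: matrix_vector_mul_assoc[symmetric] matrix_vector_mul_transpose_cancel[OF assms]
          del: transpose_matrix_vector)
    then have "(*v) k ` (*v) g ` l = (*v) g ` (*v) h ` l" by (simp add: image_image)
    then show "(*v) k ` (*v) g ` l = (*v) g ` l" using l(3) h(1) by simp
  qed
  then have "image ((*v) g) ` {l. subspace l \<and> dim l = 1 \<and> (\<forall>h\<in>H. (*v) h ` l = l)}
      \<subseteq> {l. subspace l \<and> dim l = 1 \<and> (\<forall>h\<in>(\<lambda>h. g ** h ** transpose g) ` H. (*v) h ` l = l)}"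
    by (intro image_subsetI) (elim CollectE conjE)
  then show ?thesis
    unfolding invariant_line_span_def linear_span_image[OF matrix_vector_mul_linear, symmetric] image_Union
    by (intro span_mono Union_mono)
qed

lemma image_invariant_line_span_conjugate:
  assumes g: "orthogonal_matrix (g :: real^'n^'n)"
  shows "(*v) g ` invariant_line_span H = invariant_line_span ((\<lambda>h. g ** h ** transpose g) ` H)"
    (is "_ = invariant_line_span ?K")
proof
  \<comment> \<open>Conjugating back recovers \<open>H\<close>, so the inclusion just proved,
    applied to \<open>transpose g\<close> and \<open>?K\<close>, gives the reverse
    inclusion.\<close>
  have "(\<lambda>h. transpose g ** h ** transpose (transpose g)) ` ?K = H"
  proof -
    have "transpose g ** (g ** h ** transpose g) ** g = h" for h
      using g unfolding orthogonal_matrix_def by (metis matrix_mul_assoc matrix_mul_lid matrix_mul_rid)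
    then show ?thesis by (simp add: image_image)
  qed
  then have *: "(*v) (transpose g) ` invariant_line_span ?K \<subseteq> invariant_line_span H"
    using image_invariant_line_span_conjugate_subset[of "transpose g" ?K] g
    by (simp add: orthogonal_matrix_transpose del: transpose_matrix_vector)
  show "invariant_line_span ?K \<subseteq> (*v) g ` invariant_line_span H"
  proof
    fix x assume "x \<in> invariant_line_span ?K"
    then have "transpose g *v x \<in> invariant_line_span H" using * by blast
    then show "x \<in> (*v) g ` invariant_line_span H"
      using matrix_vector_mul_transpose_cancel(2)[OF g, of x] by (metis imageI)
  qed
qed (rule image_invariant_line_span_conjugate_subset[OF g])

text \<open>The preimage of L(H) under \<open>g\<close> is L of \<open>H\<close> conjugated by the
  inverse of \<open>g\<close>; this conjugate remains inside \<open>G\<close>, and surjectivity of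
  \<open>g\<close> preserves properness.\<close>

lemma vimage_group_arrangement:
  assumes G: "subgroup G orthogonal_group" and g: "g \<in> G" and X: "X \<in> group_arrangement G"
  shows "(*v) g -` X \<in> group_arrangement G"
proof -
  note D = subgroup_orthogonal_groupD[OF G]
  obtain H where H: "subgroup H orthogonal_group" "H \<subseteq> G" "X = invariant_line_span H" "X \<noteq> UNIV"
    using X by (auto simp: group_arrangement_def subgroup_orthogonal_subgroup_iff[OF G])
  have og: "orthogonal_matrix (transpose g)"
    using D(1,4) g by blast
  let ?K = "(\<lambda>h. transpose g ** h ** transpose (transpose g)) ` H"
  have "(*v) g -` X = invariant_line_span ?K"
    using vimage_orthogonal_matrix[OF D(1)[OF g], of X] image_invariant_line_span_conjugate[OF og, of H] H(3)
    by simp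
  moreover have "subgroup ?K orthogonal_group"
    using H(1) og by (rule subgroup_conjugate_orthogonal)
  moreover have "?K \<subseteq> G"
    using H(2) g D by auto
  moreover have "(*v) g -` X \<noteq> UNIV"
  proof
    assume *: "(*v) g -` X = UNIV"
    have "y \<in> X" for y
      using matrix_vector_mul_transpose_cancel(2)[OF D(1)[OF g], of y] *
      by (metis UNIV_I vimageD)
    with H(4) show False by blast
  qed
  ultimately show ?thesis
    unfolding group_arrangement_def subgroup_orthogonal_subgroup_iff[OF G] by blast
qed

section \<open>The action on the model and its stabilizers\<close>

text \<open>Preimages commute with intersections, and those of proper sets under a surjection are
  proper. This keeps the index set of the components stable under the action.\<close>

lemma vimage_intersections_pos:
  assumes "surj f" "\<And>X. X \<in> \<A> \<Longrightarrow> f -` X \<in> \<A>" "X \<in> intersections_pos \<A>"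
  shows "f -` X \<in> intersections_pos \<A>"
proof -
  obtain \<B> where B: "\<B> \<subseteq> \<A>" "X = \<Inter>\<B>" "X \<noteq> UNIV"
    using assms(3) by (auto simp: intersections_pos_def intersections_def)
  have "f -` X = \<Inter> (vimage f ` \<B>)" "vimage f ` \<B> \<subseteq> \<A>"
    using B assms(2) by auto
  moreover have "f -` X \<noteq> UNIV"
    using assms(1) B(3) by (metis surj_image_vimage_eq)
  ultimately show ?thesis
    unfolding intersections_pos_def intersections_def by blast
qed

lemma mem_intersections_posI:
  assumes "X \<in> \<A>" "X \<noteq> UNIV"
  shows "X \<in> intersections_pos \<A>"
proof -
  have "X = \<Inter>{X}" "{X} \<subseteq> \<A>" using assms(1) by auto
  then show ?thesis
    using assms(2) unfolding intersections_pos_def intersections_def by blast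
qed

text \<open>The outer action reads the inner result at the preimage of \<open>X\<close> under
  \<open>f\<close>; the hypothesis ensures that this is a true component and not the value
  \<open>undefined\<close>.\<close>

lemma model_action_comp:
  assumes "\<And>X. X \<in> intersections_pos \<A> \<Longrightarrow> f -` X \<in> intersections_pos \<A>"
  shows "model_action \<A> f (model_action \<A> g \<omega>) = model_action \<A> (f \<circ> g) \<omega>"
  using assms by (auto simp: model_action_def image_comp vimage_comp[symmetric] fun_eq_iff image_image)

text \<open>The action always produces an extensional family, so only such families can be fixed by
  the identity.\<close>

lemma model_action_id:
  assumes "snd \<omega> \<in> extensional (intersections_pos \<A>)"
  shows "model_action \<A> (\<lambda>x. x) \<omega> = \<omega>"
  using assms by (auto simp: model_action_def prod_eq_iff fun_eq_iff extensional_def)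

text \<open>L of the stabilizer can be a member of the arrangement only once the stabilizer is known
  to be a subgroup. This follows from the action laws, valid for every extensional family.\<close>

lemma subgroup_stabilizer_model_action:
  assumes G: "subgroup G orthogonal_group"
    and \<omega>: "snd \<omega> \<in> extensional (intersections_pos (group_arrangement G))"
  shows "subgroup (stabilizer (orthogonal_group\<lparr>carrier := G\<rparr>)
           (\<lambda>g. model_action (group_arrangement G) ((*v) g)) \<omega>) orthogonal_group"
    (is "subgroup ?S _")
proof -
  let ?act = "\<lambda>g. model_action (group_arrangement G) ((*v) g)"
  note D = subgroup_orthogonal_groupD[OF G]
  have S: "?S = {g \<in> G. ?act g \<omega> = \<omega>}"
    by (simp add: stabilizer_def)
  have pos: "(*v) g -` X \<in> intersections_pos (group_arrangement G)"
    if "g \<in> G" "X \<in> intersections_pos (group_arrangement G)" for g X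
    using orthogonal_transformation_surj[OF orthogonal_transformation_matrix_vector_mult[OF D(1)[OF that(1)]]]
      vimage_group_arrangement[OF G that(1)] that(2) by (rule vimage_intersections_pos)
  have comp: "?act g (?act h \<omega>) = ?act (g ** h) \<omega>" if "g \<in> G" for g h
  proof -
    have "(*v) g \<circ> (*v) h = (*v) (g ** h)" by (auto simp: matrix_vector_mul_assoc)
    then show ?thesis using model_action_comp[OF pos[OF that]] by simp
  qed
  have id: "?act (mat 1) \<omega> = \<omega>"
    using model_action_id[OF \<omega>] by (simp add: matrix_vector_mul_lid[abs_def])
  show ?thesis unfolding S
  proof (rule subgroup_orthogonal_groupI)
    fix g assume g: "g \<in> {g \<in> G. ?act g \<omega> = \<omega>}"
    then have "?act (transpose g) \<omega> = ?act (transpose g ** g) \<omega>"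
      using comp[OF D(4), of g g] by simp
    also have "\<dots> = \<omega>"
      using D(1) g id by (simp add: orthogonal_matrix_def)
    finally show "transpose g \<in> {g \<in> G. ?act g \<omega> = \<omega>}"
      using g D(4) by blast
  next
    fix g h assume "g \<in> {g \<in> G. ?act g \<omega> = \<omega>}" "h \<in> {g \<in> G. ?act g \<omega> = \<omega>}"
    then show "g ** h \<in> {g \<in> G. ?act g \<omega> = \<omega>}"
      using comp[of g h] D(3)[of g h] by simp
  qed (use D(1,2) id in auto)
qed

section \<open>Point stabilizers are elementary abelian\<close>

theorem theorem3p1:
  fixes G :: "(real^'n^'n) set"
  assumes "subgroup G orthogonal_group"
    and "finite G"
  shows "digitalization (orthogonal_group\<lparr>carrier := G\<rparr>)
           (\<lambda>g. model_action (group_arrangement G) ((*v) g))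
           (maximal_model (group_arrangement G))"
  unfolding digitalization_def
proof
  fix \<omega> assume "\<omega> \<in> maximal_model (group_arrangement G)"
  \<comment> \<open>Membership in the ambient product makes each component of
    \<open>\<omega>\<close> a line in the corresponding quotient.\<close>
  then have "\<omega> \<in> topspace (ambient_top (group_arrangement G))"
    unfolding maximal_model_def by (rule subsetD[OF closure_of_subset_topspace])
  then have \<omega>: "snd \<omega> \<in> (\<Pi>\<^sub>E X\<in>intersections_pos (group_arrangement G). topspace (proj_quotient_top X))"
    by (auto simp: ambient_top_def)
  define S where "S = stabilizer (orthogonal_group\<lparr>carrier := G\<rparr>)
      (\<lambda>g. model_action (group_arrangement G) ((*v) g)) \<omega>"
  have SG: "S \<subseteq> G"
    and fixS: "\<And>g. g \<in> S \<Longrightarrow> model_action (group_arrangement G) ((*v) g) \<omega> = \<omega>"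
    by (auto simp: S_def stabilizer_def)
  have sgS: "subgroup S orthogonal_group"
    unfolding S_def using assms(1) \<omega>
    by (intro subgroup_stabilizer_model_action) (auto simp: PiE_iff)
  note D = subgroup_orthogonal_groupD[OF sgS]
  have L: "invariant_line_span S = UNIV"
  proof (rule ccontr)
    let ?L = "invariant_line_span S"
    assume "?L \<noteq> UNIV"
    then have "?L \<in> group_arrangement G"
      using sgS SG by (auto simp: group_arrangement_def subgroup_orthogonal_subgroup_iff[OF assms(1)])
    then have pos: "?L \<in> intersections_pos (group_arrangement G)"
      using \<open>?L \<noteq> UNIV\<close> by (rule mem_intersections_posI)
    then have "snd \<omega> ?L \<in> topspace (proj_quotient_top ?L)"
      using \<omega> by (rule PiE_mem[rotated])
    with D(1) have "\<exists>h\<in>S. image (image ((*v) h)) (snd \<omega> ?L) \<noteq> snd \<omega> ?L"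
      by (rule no_invariant_point_in_quotient)
    then obtain h where h: "h \<in> S" "image (image ((*v) h)) (snd \<omega> ?L) \<noteq> snd \<omega> ?L" ..
    have "inj ((*v) h)"
      using D(1)[OF h(1)]
      by (intro orthogonal_transformation_inj orthogonal_transformation_matrix_vector_mult)
    \<comment> \<open>Because \<open>h\<close> preserves \<open>?L\<close>, the action does not
      permute this component with another one: \<open>h\<close> acts on the line at
      \<open>?L\<close> itself, which it must therefore fix.\<close>
    then have "(*v) h -` ?L = ?L"
      using image_invariant_line_span[OF h(1)] by (metis inj_vimage_image_eq)
    then have "snd (model_action (group_arrangement G) ((*v) h) \<omega>) ?L
        = image (image ((*v) h)) (snd \<omega> ?L)"
      using pos by (simp add: model_action_def)
    with fixS[OF h(1)] h(2) show False by simp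
  qed
  have "group (orthogonal_group\<lparr>carrier := S\<rparr>)"
    using group_orthogonal_group sgS by (rule group.subgroup_imp_group)
  moreover have "finite S" using SG assms(2) by (rule finite_subset)
  \<comment> \<open>Since the invariant lines now span the whole space, every member of
    \<open>S\<close> squares to the identity matrix, and the criterion for finite groups of exponent
    two applies.\<close>
  ultimately show "elementary_abelian_2_group (orthogonal_group\<lparr>carrier := G\<rparr>\<lparr>carrier :=
      stabilizer (orthogonal_group\<lparr>carrier := G\<rparr>) (\<lambda>g. model_action (group_arrangement G) ((*v) g)) \<omega>\<rparr>)"
    unfolding S_def[symmetric]
    using group.elementary_abelian_2_groupI[of "orthogonal_group\<lparr>carrier := S\<rparr>"]
      square_eq_1_if_invariant_line_span_UNIV[OF L _ D(1)]
    by (simp add: orthogonal_group_def)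
qed

end
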